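(* Let $S\subset\mathbb{Z}^2$ be a finite hole free set. Let $A\subset S$ and $B=S\setminus A$, with $A$ and $B$ both nonempty. Then Condition H (separation by a sequence of affine hyperplanes) and the $3$-parallelogram condition for the pair $(A,B)$ are equivalent.
   Context: A set $S\subset\mathbb{Z}^d$ is hole free if $S=\operatorname{conv}(S)\cap\mathbb{Z}^d$, where $\operatorname{conv}$ denotes the convex hull in $\mathbb{R}^d$. Let $A,B\subset\mathbb{Z}^d$ be nonempty disjoint sets and $S=A\cup B$ (here $d=2$). Separation in an affine subspace. Let $L\subset\mathbb{R}^d$ be an affine subspace of dimension $l$. A hyperplane in $L$ is an affine subspace $P\subset L$ of dimension $l-1$. $P$ separates $A$ and $B$ in $L$ if there exist two disjoint connected components $R^+$ and $R^-$ of $L\setminus P$ such that $R^+\cup R^-=L\setminus P$, $R^+\cap S\subset A$ and $R^-\cap S\subset B$. Condition H. There exist $k$ with $0\le k\le d$ and affine subspaces $H_k\subset H_{k+1}\subset\cdots\subset H_d=\mathbb{R}^d$ with $\dim H_i=i$ such that (1) $H_k\cap S\subset A$ or $H_k\cap S\subset B$, and (2) for every $i$ with $k+1\le i\le d$, $H_{i-1}$ separates $A$ and $B$ in $H_i$. The $3$-parallelogram condition. For every $k'\in\{1,2,3\}$, all $a_1,\dots,a_{k'}\in A$ and all $b_1,\dots,b_{k'}\in B$ (repetitions allowed), $\sum_{i=1}^{k'}a_i\ne\sum_{i=1}^{k'}b_i$. *)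

theory Defs
  imports "HOL-Analysis.Analysis"
begin

definition int_lattice :: "(real ^ 'd) set" where
  "int_lattice = {x. \<forall>i. x $ i \<in> \<int>}"

definition hole_free :: "(real ^ 'd) set \<Rightarrow> bool" where
  "hole_free S \<longleftrightarrow> S = convex hull S \<inter> int_lattice"

definition separates_in ::
  "(real ^ 'd) set \<Rightarrow> (real ^ 'd) set \<Rightarrow> (real ^ 'd) set \<Rightarrow> (real ^ 'd) set \<Rightarrow> bool" where
  "separates_in L P A B \<longleftrightarrow>
     affine L \<and> affine P \<and> P \<subseteq> L \<and> aff_dim P = aff_dim L - 1 \<and>
     (\<exists>Rp \<in> components (L - P). \<exists>Rm \<in> components (L - P).
        Rp \<inter> Rm = {} \<and> Rp \<union> Rm = L - P \<and>
        Rp \<inter> (A \<union> B) \<subseteq> A \<and> Rm \<inter> (A \<union> B) \<subseteq> B)"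

text \<open>The flag is a function on the naturals of which only the values at indices from \<open>k\<close> to the
  dimension \<open>d = CARD('d)\<close> matter.\<close>

definition condition_H :: "(real ^ 'd) set \<Rightarrow> (real ^ 'd) set \<Rightarrow> bool" where
  "condition_H A B \<longleftrightarrow>
     (\<exists>k \<le> CARD('d). \<exists>H :: nat \<Rightarrow> (real ^ 'd) set.
        (\<forall>i \<in> {k..CARD('d)}. affine (H i) \<and> aff_dim (H i) = int i) \<and>
        (\<forall>i \<in> {k..<CARD('d)}. H i \<subseteq> H (Suc i)) \<and>
        H CARD('d) = UNIV \<and>
        (H k \<inter> (A \<union> B) \<subseteq> A \<or> H k \<inter> (A \<union> B) \<subseteq> B) \<and>
        (\<forall>i \<in> {k + 1..CARD('d)}. separates_in (H i) (H (i - 1)) A B))"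

definition parallelogram_condition :: "nat \<Rightarrow> (real ^ 'd) set \<Rightarrow> (real ^ 'd) set \<Rightarrow> bool" where
  "parallelogram_condition m A B \<longleftrightarrow>
     (\<forall>k \<in> {1..m}. \<forall>a b :: nat \<Rightarrow> real ^ 'd.
        (\<forall>i \<in> {1..k}. a i \<in> A) \<and> (\<forall>i \<in> {1..k}. b i \<in> B) \<longrightarrow>
        (\<Sum>i = 1..k. a i) \<noteq> (\<Sum>i = 1..k. b i))"

end

theory Submission imports Defs begin

text \<open>For finite sets, strictly separated convex hulls give Condition H with a single line, so
  everything reduces to showing that the 3-parallelogram condition makes the convex hulls of
  \<open>A\<close> and \<open>B\<close> disjoint. If they meet, then by Caratheodory either a point of one colour lies in a
  triangle (or segment) of the other, or an \<open>A\<close>-segment crosses a \<open>B\<close>-segment. Choose such a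
  configuration containing as few points of \<open>S\<close> as possible. A minimal triangle with vertices
  in \<open>B\<close> has no further points of \<open>B\<close>, and a wrap-around argument modulo the lattice generated by
  its edges yields a forbidden sum of length 2 or 3. A minimal crossing quadrilateral has one
  of its parallelogram completions inside it, which is a lattice point and hence gives a sum
  of length 2 or a smaller crossing. Conversely, under Condition H the nonnegativity of the
  separating functionals forces the terms of two equal sums down the flag to its last space,
  where only one colour is left.\<close>

section \<open>Barycentric coordinates in segments and triangles\<close>

lemma convex_hull_2I:
  assumes "x = u *\<^sub>R a + v *\<^sub>R b" "0 \<le> u" "0 \<le> v" "u + v = 1"
  shows "x \<in> convex hull {a, b}"
  unfolding convex_hull_2 using assms by blast

lemma convex_hull_3I:
  assumes "x = u *\<^sub>R a + v *\<^sub>R b + w *\<^sub>R c" "0 \<le> u" "0 \<le> v" "0 \<le> w" "u + v + w = 1"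
  shows "x \<in> convex hull {a, b, c}"
  unfolding convex_hull_3 using assms by blast

lemma convex_hull_3E:
  assumes "x \<in> convex hull {a, b, c}"
  obtains u v w where "x = u *\<^sub>R a + v *\<^sub>R b + w *\<^sub>R c" "0 \<le> u" "0 \<le> v" "0 \<le> w" "u + v + w = 1"
  using assms unfolding convex_hull_3 by blast

section \<open>Two-coloured lattice sets\<close>

text \<open>The assumptions are symmetric in the two colours, so every result can be reused with
  \<open>A\<close> and \<open>B\<close> exchanged. Equal sums of length 1 are excluded by
  \<open>disjoint\<close>. The plane enters only in \<open>disjoint_hulls\<close>, through the
  Caratheodory bound.\<close>

locale lattice_coloring =
  fixes \<Lambda> A B :: "'a::euclidean_space set"
  assumes finite_A: "finite A" and finite_B: "finite B"
    and disjoint: "A \<inter> B = {}"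
    and lattice: "A \<union> B \<subseteq> \<Lambda>"
    and lattice_diff: "\<And>x y. x \<in> \<Lambda> \<Longrightarrow> y \<in> \<Lambda> \<Longrightarrow> x - y \<in> \<Lambda>"
    and no_holes: "\<And>x. x \<in> convex hull (A \<union> B) \<Longrightarrow> x \<in> \<Lambda> \<Longrightarrow> x \<in> A \<union> B"
    and sum2: "\<And>a1 a2 b1 b2. \<lbrakk>a1 \<in> A; a2 \<in> A; b1 \<in> B; b2 \<in> B\<rbrakk> \<Longrightarrow> a1 + a2 \<noteq> b1 + b2"
    and sum3: "\<And>a1 a2 a3 b1 b2 b3. \<lbrakk>a1 \<in> A; a2 \<in> A; a3 \<in> A; b1 \<in> B; b2 \<in> B; b3 \<in> B\<rbrakk>
      \<Longrightarrow> a1 + a2 + a3 \<noteq> b1 + b2 + b3"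
begin

lemma lattice_coloring_swap: "lattice_coloring \<Lambda> B A"
proof
  show "x \<in> B \<union> A" if "x \<in> convex hull (B \<union> A)" "x \<in> \<Lambda>" for x
    using no_holes that by (simp add: Un_commute)
  show "b1 + b2 \<noteq> a1 + a2" if "b1 \<in> B" "b2 \<in> B" "a1 \<in> A" "a2 \<in> A" for a1 a2 b1 b2
    using sum2[of a1 a2 b1 b2] that by metis
  show "b1 + b2 + b3 \<noteq> a1 + a2 + a3"
    if "b1 \<in> B" "b2 \<in> B" "b3 \<in> B" "a1 \<in> A" "a2 \<in> A" "a3 \<in> A" for a1 a2 a3 b1 b2 b3
    using sum3[of a1 a2 a3 b1 b2 b3] that by metis
qed (use finite_A finite_B disjoint lattice lattice_diff in auto)

lemma lattice_add: "x \<in> \<Lambda> \<Longrightarrow> y \<in> \<Lambda> \<Longrightarrow> x + y \<in> \<Lambda>"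
  using lattice_diff[of x "0 - y"] lattice_diff[of y y] lattice_diff[of 0 y] by simp

lemma in_lattice: "x \<in> A \<union> B \<Longrightarrow> x \<in> \<Lambda>"
  using lattice by blast

lemma in_hull_imp: "\<lbrakk>x \<in> convex hull V; V \<subseteq> A \<union> B; x \<in> \<Lambda>\<rbrakk> \<Longrightarrow> x \<in> A \<union> B"
  using no_holes hull_mono by blast

section \<open>Points of one colour in a triangle of the other\<close>

text \<open>Take \<open>p\<close> and \<open>q\<close> in \<open>A\<close> extremal for a functional that is constant on the line through \<open>b2\<close>
  and \<open>b3\<close>. The barycentric coordinates of \<open>p + q\<close> add up to 2. If one of them is at least 1,
  subtracting that vertex gives a point of \<open>A\<close> (by \<open>sum2\<close>) that contradicts extremality; otherwise
  \<open>b1 + b2 + b3 - p - q\<close> is a lattice point of the triangle, contradicting \<open>sum3\<close> or \<open>sum2\<close>.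
  The degenerate case \<open>b2 = b3\<close> covers segments.\<close>

lemma no_A_in_minimal_triangle:
  assumes b: "b1 \<in> B" "b2 \<in> B" "b3 \<in> B"
    and vertices: "B \<inter> convex hull {b1, b2, b3} \<subseteq> {b1, b2, b3}"
    and off_line: "\<And>c. b1 \<noteq> b2 + c *\<^sub>R (b3 - b2)"
    and base: "A \<inter> convex hull {b2, b3} = {}"
  shows "A \<inter> convex hull {b1, b2, b3} = {}"
proof (rule ccontr)
  let ?T = "convex hull {b1, b2, b3}"
  assume nonempty: "A \<inter> ?T \<noteq> {}"
  define w where "w = b3 - b2"
  \<comment> \<open>The component of \<open>b1 - b2\<close> orthogonal to the edge from
    \<open>b2\<close> to \<open>b3\<close>. If \<open>b2 = b3\<close>, the subtracted term vanishes
    and \<open>n = b1 - b2\<close>.\<close>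
  define n where "n = (b1 - b2) - ((b1 - b2) \<bullet> w / (w \<bullet> w)) *\<^sub>R w"
  have nw: "n \<bullet> w = 0"
    by (cases "w = 0") (simp_all add: n_def inner_diff_left)
  have "n \<noteq> 0"
    using off_line[of "(b1 - b2) \<bullet> w / (w \<bullet> w)"] by (auto simp: n_def w_def algebra_simps)
  moreover have "n \<bullet> (b1 - b2) = n \<bullet> n"
  proof -
    have "b1 - b2 = n + ((b1 - b2) \<bullet> w / (w \<bullet> w)) *\<^sub>R w" by (simp add: n_def)
    then show ?thesis using nw by (metis add.right_neutral inner_add_right inner_scaleR_right mult_zero_right)
  qed
  ultimately have n12: "n \<bullet> b2 < n \<bullet> b1"
    by (metis diff_gt_0_iff_gt inner_diff_right inner_gt_zero_iff)
  have n23: "n \<bullet> b3 = n \<bullet> b2"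
    using nw by (simp add: w_def inner_diff_right)
  have strict: "n \<bullet> b2 < n \<bullet> a \<and> n \<bullet> a < n \<bullet> b1" if "a \<in> A \<inter> ?T" for a
  proof -
    from that obtain x y z where a: "a = x *\<^sub>R b1 + y *\<^sub>R b2 + z *\<^sub>R b3"
      and xyz: "0 \<le> x" "0 \<le> y" "0 \<le> z" "x + y + z = 1"
      by (blast elim: convex_hull_3E)
    have "x \<noteq> 0"
    proof
      assume "x = 0"
      then have "a \<in> convex hull {b2, b3}"
        using a xyz by (intro convex_hull_2I[of _ y _ z]) auto
      then show False using base that by blast
    qed
    moreover have "x \<noteq> 1"
    proof
      assume "x = 1"
      then have "y = 0" "z = 0" using xyz by auto
      then show False using a \<open>x = 1\<close> that b disjoint by auto
    qed
    moreover have "n \<bullet> a = x * (n \<bullet> b1) + (1 - x) * (n \<bullet> b2)"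
    proof -
      have "1 - x = y + z" using xyz by simp
      then show ?thesis by (simp only: a inner_add_right inner_scaleR_right n23 distrib_right)
    qed
    then have "n \<bullet> a - n \<bullet> b2 = x * (n \<bullet> b1 - n \<bullet> b2)"
      "n \<bullet> b1 - n \<bullet> a = (1 - x) * (n \<bullet> b1 - n \<bullet> b2)" by (simp_all add: algebra_simps)
    moreover have "0 < x" "0 < 1 - x" using calculation xyz by auto
    ultimately show ?thesis
      using n12 by (metis diff_gt_0_iff_gt mult_pos_pos)
  qed
  have fin: "finite (A \<inter> ?T)" using finite_A by simp
  obtain p where p: "p \<in> A \<inter> ?T" "\<And>a. a \<in> A \<inter> ?T \<Longrightarrow> n \<bullet> a \<le> n \<bullet> p"
    using ex_is_arg_min_if_finite[OF fin nonempty, of "\<lambda>a. - (n \<bullet> a)"]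
    by (auto simp: is_arg_min_linorder)
  obtain q where q: "q \<in> A \<inter> ?T" "\<And>a. a \<in> A \<inter> ?T \<Longrightarrow> n \<bullet> q \<le> n \<bullet> a"
    using ex_is_arg_min_if_finite[OF fin nonempty, of "\<lambda>a. n \<bullet> a"]
    by (auto simp: is_arg_min_linorder)
  have sub: "{b1, b2, b3} \<subseteq> A \<union> B" using b by auto
  have no: "p + q - c \<notin> ?T" if c: "c \<in> {b1, b2, b3}" for c
  proof
    assume T: "p + q - c \<in> ?T"
    have cB: "c \<in> B" using c b by auto
    have "p + q - c \<in> A \<union> B"
      using T sub p q cB in_lattice by (intro in_hull_imp lattice_diff lattice_add) auto
    moreover have "p + q - c \<notin> B"
      using sum2[of p q c "p + q - c"] p q cB by auto
    ultimately have "p + q - c \<in> A \<inter> ?T" using T by auto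
    \<comment> \<open>Extremality places the level of \<open>c\<close> between those of
      \<open>q\<close> and \<open>p\<close>, whereas by \<open>strict\<close> every vertex lies
      outside that range.\<close>
    from p(2)[OF this] q(2)[OF this] have "n \<bullet> q \<le> n \<bullet> c" "n \<bullet> c \<le> n \<bullet> p"
      by (auto simp: inner_add_right inner_diff_right)
    then show False using c strict[OF p(1)] strict[OF q(1)] n23 by auto
  qed
  obtain x y z where pe: "p = x *\<^sub>R b1 + y *\<^sub>R b2 + z *\<^sub>R b3"
      and xyz: "0 \<le> x" "0 \<le> y" "0 \<le> z" "x + y + z = 1"
    using p by (blast elim: convex_hull_3E)
  obtain x' y' z' where qe: "q = x' *\<^sub>R b1 + y' *\<^sub>R b2 + z' *\<^sub>R b3"
      and xyz': "0 \<le> x'" "0 \<le> y'" "0 \<le> z'" "x' + y' + z' = 1"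
    using q by (blast elim: convex_hull_3E)
  have "x + x' < 1"
  proof (rule ccontr)
    assume "\<not> x + x' < 1"
    then have "p + q - b1 \<in> ?T"
      by (intro convex_hull_3I[of _ "x + x' - 1" _ "y + y'" _ "z + z'"])
        (use xyz xyz' in \<open>auto simp: pe qe algebra_simps\<close>)
    then show False using no by blast
  qed
  moreover have "y + y' < 1"
  proof (rule ccontr)
    assume "\<not> y + y' < 1"
    then have "p + q - b2 \<in> ?T"
      by (intro convex_hull_3I[of _ "x + x'" _ "y + y' - 1" _ "z + z'"])
        (use xyz xyz' in \<open>auto simp: pe qe algebra_simps\<close>)
    then show False using no by blast
  qed
  moreover have "z + z' < 1"
  proof (rule ccontr)
    assume "\<not> z + z' < 1"
    then have "p + q - b3 \<in> ?T"
      by (intro convex_hull_3I[of _ "x + x'" _ "y + y'" _ "z + z' - 1"])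
        (use xyz xyz' in \<open>auto simp: pe qe algebra_simps\<close>)
    then show False using no by blast
  qed
  \<comment> \<open>The coordinates are one minus those of \<open>p + q\<close>, hence positive,
    with sum 3 - 2 = 1.\<close>
  ultimately have T: "b1 + b2 + b3 - p - q \<in> ?T"
    by (intro convex_hull_3I[of _ "1 - x - x'" _ "1 - y - y'" _ "1 - z - z'"])
      (use xyz xyz' in \<open>auto simp: pe qe algebra_simps\<close>)
  then have "b1 + b2 + b3 - p - q \<in> A \<union> B"
    using sub p q b in_lattice by (intro in_hull_imp lattice_diff lattice_add) auto
  moreover have "b1 + b2 + b3 - p - q \<notin> A"
    using sum3[of p q "b1 + b2 + b3 - p - q" b1 b2 b3] p q b by auto
  \<comment> \<open>If this point is a vertex, that vertex cancels and \<open>p + q\<close> becomes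
    the sum of the other two.\<close>
  ultimately have "b1 + b2 + b3 - p - q \<in> {b1, b2, b3}"
    using vertices T by blast
  then have "p + q = b2 + b3 \<or> p + q = b1 + b3 \<or> p + q = b1 + b2"
    by (auto simp: algebra_simps)
  then show False using sum2 p q b by blast
qed

text \<open>Induction on the number of points of \<open>B\<close> in the hull plus the number of
  vertices. A redundant vertex is dropped, which lowers the second summand only. A further point of
  \<open>B\<close> in the hull is exchanged for a vertex so that a given point of \<open>A\<close>
  stays covered, which lowers the first. Otherwise the vertices are the only points of
  \<open>B\<close>, the faces are clear by induction, and \<open>no_A_in_minimal_triangle\<close>
  applies.\<close>

lemma no_A_in_hull3:
  assumes "V \<subseteq> B" "card V \<le> 3"
  shows "A \<inter> convex hull V = {}"
  using assms
proof (induction "card (B \<inter> convex hull V) + card V" arbitrary: V rule: less_induct)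
  case less
  have finV: "finite V" using less.prems finite_B finite_subset by blast
  have IH: "A \<inter> convex hull W = {}"
    if "W \<subseteq> B" "card W \<le> card V" "W \<subseteq> convex hull V" "v \<in> V" "v \<notin> convex hull W" for W v
  proof (rule less.hyps)
    have "B \<inter> convex hull W \<subset> B \<inter> convex hull V"
      using that less.prems hull_minimal[of W "convex hull V" convex] hull_inc[of v V] by blast
    then have "card (B \<inter> convex hull W) < card (B \<inter> convex hull V)"
      using finite_B by (intro psubset_card_mono) auto
    then show "card (B \<inter> convex hull W) + card W < card (B \<inter> convex hull V) + card V"
      using that by simp
  qed (use that less.prems in auto)
  show ?case
  proof (cases "\<exists>v\<in>V. v \<in> convex hull (V - {v})")
    case True
    then obtain v where v: "v \<in> V" "v \<in> convex hull (V - {v})" by blast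
    then have "convex hull V = convex hull (V - {v})"
      by (metis hull_redundant insert_Diff)
    moreover have "card (V - {v}) < card V"
      using v(1) finV by (rule card_Diff1_less[rotated])
    ultimately show ?thesis
      using less.hyps[of "V - {v}"] less.prems by auto
  next
    case False
    then have ext: "v extreme_point_of (convex hull V) \<longleftrightarrow> v \<in> V" for v
      using extreme_point_of_convex_hull_convex_independent finV finite_imp_compact by blast
    show ?thesis
    proof (cases "B \<inter> convex hull V \<subseteq> V")
      case False
      then obtain b where b: "b \<in> B" "b \<in> convex hull V" "b \<notin> V" by blast
      show ?thesis
      proof (rule ccontr)
        assume "A \<inter> convex hull V \<noteq> {}"
        then obtain a where a: "a \<in> A" "a \<in> convex hull V" by blast
        obtain v where v: "v \<in> V" "a \<in> convex hull (insert b (V - {v}))"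
          using in_convex_hull_exchange[OF b(2) a(2)] .
        \<comment> \<open>As \<open>v\<close> is extreme, removing it keeps the hull convex, so the
          exchanged hull misses \<open>v\<close> and the count drops.\<close>
        have "convex (convex hull V - {v})"
          using ext v(1) extreme_point_of_stillconvex by blast
        moreover have "insert b (V - {v}) \<subseteq> convex hull V - {v}"
          using b v by (auto simp: hull_inc)
        ultimately have "v \<notin> convex hull (insert b (V - {v}))"
          using hull_minimal by (metis Diff_iff insertI1 subsetD)
        moreover have "card (insert b (V - {v})) \<le> card V"
          using v b finV card_Suc_Diff1[OF finV v(1)] by (simp add: card_insert_if)
        ultimately have "A \<inter> convex hull (insert b (V - {v})) = {}"
          using b v less.prems by (intro IH[of _ v]) (auto simp: hull_inc)
        then show False using a v by blast
      qed
    next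
      case True
      have smaller: "A \<inter> convex hull (V - {v}) = {}" if "v \<in> V" for v
        using that \<open>\<not> (\<exists>v\<in>V. v \<in> convex hull (V - {v}))\<close> less.prems finV
        by (intro IH[of _ v]) (auto simp: hull_inc card_Diff_singleton_if)
      consider "V = {}" | v where "V = {v}" | v w where "V = {v, w}" "v \<noteq> w"
        | u v w where "V = {u, v, w}" "u \<noteq> v" "v \<noteq> w" "u \<noteq> w"
      proof -
        have "card V = 0 \<or> card V = 1 \<or> card V = 2 \<or> card V = 3" using less.prems by linarith
        then show ?thesis
          using that finV by (auto simp: card_1_singleton_iff card_2_iff card_3_iff)
      qed
      then show ?thesis
      proof cases
        case 1
        then show ?thesis by simp
      next
        case 2
        then show ?thesis using less.prems disjoint by auto
      next
        case 3
        \<comment> \<open>A segment is treated as a triangle with the end \<open>w\<close>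
          repeated.\<close>
        then have "A \<inter> convex hull {v, w, w} = {}"
          using less.prems True smaller[of v] by (intro no_A_in_minimal_triangle) auto
        then show ?thesis using 3 by simp
      next
        case 4
        have ncol: "\<not> collinear {u, v, w}"
        proof
          assume "collinear {u, v, w}"
          then have "u \<in> convex hull {v, w} \<or> v \<in> convex hull {w, u} \<or> w \<in> convex hull {u, v}"
            by (simp add: collinear_between_cases between_mem_segment segment_convex_hull)
          moreover have "V - {u} = {v, w}" "V - {v} = {w, u}" "V - {w} = {u, v}" using 4 by auto
          ultimately show False
            using \<open>\<not> (\<exists>v\<in>V. v \<in> convex hull (V - {v}))\<close> 4(1) by (metis insertCI)
        qed
        have "u \<noteq> v + c *\<^sub>R (w - v)" for c
        proof
          assume "u = v + c *\<^sub>R (w - v)"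
          then have "collinear {u, v, w}"
            unfolding collinear_alt
            by (intro exI[of _ v] exI[of _ "w - v"])
              (auto intro: exI[of _ c] exI[of _ 0] exI[of _ 1])
          then show False using ncol by simp
        qed
        moreover have "V - {u} = {v, w}" using 4 by auto
        ultimately show ?thesis
          using less.prems True smaller[of u] 4 no_A_in_minimal_triangle[of u v w] by auto
      qed
    qed
  qed
qed

lemma no_B_in_hull3: "V \<subseteq> A \<Longrightarrow> card V \<le> 3 \<Longrightarrow> B \<inter> convex hull V = {}"
  using lattice_coloring.no_A_in_hull3[OF lattice_coloring_swap] .

section \<open>Crossing segments of opposite colours\<close>

definition crossing :: "'a \<Rightarrow> 'a \<Rightarrow> 'a \<Rightarrow> 'a \<Rightarrow> bool" where
  "crossing a1 a2 b1 b2 \<longleftrightarrow> a1 \<in> A \<and> a2 \<in> A \<and> b1 \<in> B \<and> b2 \<in> B \<and>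
     convex hull {a1, a2} \<inter> convex hull {b1, b2} \<noteq> {}"

definition hull_count :: "'a \<Rightarrow> 'a \<Rightarrow> 'a \<Rightarrow> 'a \<Rightarrow> nat" where
  "hull_count a1 a2 b1 b2 = card ((A \<union> B) \<inter> convex hull {a1, a2, b1, b2})"

text \<open>Stated with an arbitrary total weight \<open>t\<close>, because eliminating a point
  between two affine relations leaves weights that are not normalised.\<close>

lemma not_in_A_segment:
  assumes "a1 \<in> A" "a2 \<in> A" "b \<in> B" "0 \<le> u" "0 \<le> v" "0 < t" "u + v = t"
  shows "t *\<^sub>R b \<noteq> u *\<^sub>R a1 + v *\<^sub>R a2"
proof
  assume "t *\<^sub>R b = u *\<^sub>R a1 + v *\<^sub>R a2"
  then have "(1 / t) *\<^sub>R t *\<^sub>R b = (1 / t) *\<^sub>R (u *\<^sub>R a1 + v *\<^sub>R a2)" by simp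
  then have "b = (u / t) *\<^sub>R a1 + (v / t) *\<^sub>R a2"
    using assms by (simp add: scaleR_add_right)
  then have "b \<in> convex hull {a1, a2}"
    using assms by (intro convex_hull_2I[of _ "u / t" _ "v / t"]) (auto simp: field_simps)
  moreover have "card {a1, a2} \<le> 3" by (simp add: card_insert_if)
  ultimately show False using no_B_in_hull3[of "{a1, a2}"] assms by auto
qed

lemma not_in_B_segment:
  assumes "b1 \<in> B" "b2 \<in> B" "a \<in> A" "0 \<le> u" "0 \<le> v" "0 < t" "u + v = t"
  shows "t *\<^sub>R a \<noteq> u *\<^sub>R b1 + v *\<^sub>R b2"
  using lattice_coloring.not_in_A_segment[OF lattice_coloring_swap] assms by blast

text \<open>Substitute the coordinates of \<open>b1\<close> into \<open>eq\<close>. If neither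
  \<open>a1\<close> nor \<open>a2\<close> gets more weight on the right than on the left, then
  \<open>b2\<close> lies on the \<open>A\<close>-segment; if one of them does, the other lies on the
  \<open>B\<close>-segment. Both are excluded. Consequently \<open>b1\<close> is an extreme point of
  the quadrilateral.\<close>

lemma crossing_vertex:
  assumes mem: "a1 \<in> A" "a2 \<in> A" "b1 \<in> B" "b2 \<in> B"
    and uv: "0 < u" "u < 1" "0 < v" "v < 1"
    and eq: "(1 - u) *\<^sub>R a1 + u *\<^sub>R a2 = (1 - v) *\<^sub>R b1 + v *\<^sub>R b2"
  shows "b1 \<notin> convex hull {a1, a2, b2}"
proof
  assume "b1 \<in> convex hull {a1, a2, b2}"
  then obtain x y z where b1: "b1 = x *\<^sub>R a1 + y *\<^sub>R a2 + z *\<^sub>R b2"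
    and xyz: "0 \<le> x" "0 \<le> y" "0 \<le> z" "x + y + z = 1"
    by (blast elim: convex_hull_3E)
  \<comment> \<open>Stated for arbitrary \<open>c1\<close>, \<open>c2\<close> and \<open>u\<close>,
    so that it also serves with \<open>a1\<close> and \<open>a2\<close> interchanged and
    \<open>1 - u\<close> in place of \<open>u\<close>.\<close>
  have aux: False if mem: "c1 \<in> A" "c2 \<in> A"
    and u: "0 < u" "u < 1"
    and eq: "(1 - u) *\<^sub>R c1 + u *\<^sub>R c2 = (1 - v) *\<^sub>R b1 + v *\<^sub>R b2"
    and b1: "b1 = x *\<^sub>R c1 + y *\<^sub>R c2 + z *\<^sub>R b2"
    and xyz: "0 \<le> x" "0 \<le> y" "0 \<le> z" "x + y + z = 1"
    and e: "(1 - v) * x > 1 - u" for c1 c2 u x y z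
  proof -
    define e where "e = (1 - v) * x - (1 - u)"
    define c where "c = (1 - v) * z + v + e"
    have "0 < e" using e by (simp add: e_def)
    have "x \<noteq> 0" using e u by auto
    then have "0 < x" using xyz by simp
    \<comment> \<open>Here \<open>c2\<close> lies on the segment from \<open>b2\<close> to
      \<open>c1\<close>; eliminating \<open>c1\<close> through the equation for \<open>b1\<close>
      then puts it on the segment from \<open>b1\<close> to \<open>b2\<close>.\<close>
    have 1: "c *\<^sub>R c2 = ((1 - v) * z + v) *\<^sub>R b2 + e *\<^sub>R c1"
    proof -
      have c: "c = u - (1 - v) * y"
        using xyz(4) by (simp add: c_def e_def algebra_simps) (simp add: distrib_left[symmetric])
      show ?thesis using eq by (subst c) (simp add: b1 e_def algebra_simps)
    qed
    have "x *\<^sub>R c1 = b1 - y *\<^sub>R c2 - z *\<^sub>R b2" using b1 by simp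
    then have "(x * c) *\<^sub>R c2 = (x * ((1 - v) * z + v)) *\<^sub>R b2 + e *\<^sub>R (b1 - y *\<^sub>R c2 - z *\<^sub>R b2)"
      using arg_cong[OF 1, of "\<lambda>w. x *\<^sub>R w"] by (simp add: scaleR_add_right) (metis mult.commute scaleR_scaleR)
    then have 2: "(x * c + e * y) *\<^sub>R c2 = e *\<^sub>R b1 + (x * ((1 - v) * z + v) - e * z) *\<^sub>R b2"
      by (simp add: algebra_simps)
    have ex: "e \<le> x * (1 - v)" using u by (simp add: e_def mult.commute)
    have "x * ((1 - v) * z + v) - e * z = z * (x * (1 - v) - e) + x * v"
      by (simp add: algebra_simps)
    moreover have "0 \<le> z * (x * (1 - v) - e) + x * v"
      using ex xyz uv by (intro add_nonneg_nonneg mult_nonneg_nonneg) auto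
    ultimately have 3: "0 \<le> x * ((1 - v) * z + v) - e * z" by simp
    have 4: "e + (x * ((1 - v) * z + v) - e * z) = x * c + e * y"
    proof -
      have "e * (x + y + z) = e" using xyz by simp
      then show ?thesis by (simp add: c_def algebra_simps)
    qed
    show False
      using not_in_B_segment[OF \<open>b1 \<in> B\<close> \<open>b2 \<in> B\<close> mem(2) _ 3 _ 4] 2 3 4 \<open>0 < e\<close> by auto
  qed
  consider "(1 - v) * x > 1 - u" | "(1 - v) * y > u" | "(1 - v) * x \<le> 1 - u" "(1 - v) * y \<le> u"
    by linarith
  then show False
  proof cases
    case 1
    then show ?thesis using aux[of a1 a2 u x y z] mem uv eq b1 xyz by blast
  next
    case 2
    then show ?thesis
      using aux[of a2 a1 "1 - u" y x z] mem uv eq b1 xyz by (simp add: algebra_simps)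
  next
    case 3
    have "((1 - v) * z + v) *\<^sub>R b2 = ((1 - u) - (1 - v) * x) *\<^sub>R a1 + (u - (1 - v) * y) *\<^sub>R a2"
      using eq by (simp add: b1 algebra_simps)
    moreover have "((1 - u) - (1 - v) * x) + (u - (1 - v) * y) = (1 - v) * z + v"
    proof -
      have "(1 - v) * (x + y + z) = 1 - v" using xyz by simp
      then show ?thesis by (simp add: algebra_simps)
    qed
    moreover have "0 < (1 - v) * z + v"
      using uv xyz by (intro add_nonneg_pos mult_nonneg_nonneg) auto
    ultimately show False
      using not_in_A_segment[OF mem(1,2,4)] 3 by auto
  qed
qed

text \<open>The hypotheses on \<open>u\<close> and \<open>v\<close> say that \<open>a1\<close> is the vertex for which the completion
  \<open>b1 + b2 - a1\<close> of the parallelogram lies in the quadrilateral, on the side of \<open>b1\<close>. Being in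
  \<open>B\<close> by \<open>sum2\<close>, it can replace \<open>b1\<close>.\<close>

lemma crossing_step_min:
  assumes mem: "a1 \<in> A" "a2 \<in> A" "b1 \<in> B" "b2 \<in> B"
    and uv: "0 < u" "u < 1" "0 < v" "v < 1" "u \<le> 1 - v" "1 \<le> v + v"
    and eq: "(1 - u) *\<^sub>R a1 + u *\<^sub>R a2 = (1 - v) *\<^sub>R b1 + v *\<^sub>R b2"
  shows "\<exists>d. crossing a1 a2 d b2 \<and> hull_count a1 a2 d b2 < hull_count a1 a2 b1 b2"
proof -
  define d where "d = b1 + b2 - a1"
  \<comment> \<open>Barycentric coordinates of \<open>d\<close> with respect to \<open>a1\<close>,
    \<open>a2\<close>, \<open>b1\<close>, found by solving \<open>eq\<close> for \<open>b2\<close>.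
    The bounds on \<open>u\<close> and \<open>v\<close> make them nonnegative.\<close>
  define x y z where "x = (1 - v - u) / v" and "y = u / v" and "z = (v + v - 1) / v"
  have "v *\<^sub>R d = v *\<^sub>R (x *\<^sub>R a1 + y *\<^sub>R a2 + z *\<^sub>R b1)"
  proof -
    have "v *\<^sub>R (x *\<^sub>R a1 + y *\<^sub>R a2 + z *\<^sub>R b1) =
        (1 - v - u) *\<^sub>R a1 + u *\<^sub>R a2 + (v + v - 1) *\<^sub>R b1"
      using uv by (simp add: x_def y_def z_def scaleR_add_right)
    also have "\<dots> = ((1 - u) *\<^sub>R a1 + u *\<^sub>R a2) - v *\<^sub>R a1 + (v + v - 1) *\<^sub>R b1"
      by (simp add: algebra_simps)
    also have "\<dots> = v *\<^sub>R d"
      unfolding eq d_def by (simp add: algebra_simps flip: scaleR_add_left)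
    finally show ?thesis by (rule sym)
  qed
  then have d: "d = x *\<^sub>R a1 + y *\<^sub>R a2 + z *\<^sub>R b1"
    using uv by (metis less_irrefl scaleR_left_imp_eq)
  have xyz: "0 \<le> x" "0 \<le> y" "0 \<le> z" "x + y + z = 1"
    using uv by (auto simp: x_def y_def z_def add_divide_distrib[symmetric])
  have dT: "d \<in> convex hull {a1, a2, b1}"
    using d xyz by (rule convex_hull_3I)
  have "d \<in> \<Lambda>"
    unfolding d_def using mem in_lattice by (intro lattice_diff lattice_add) auto
  then have "d \<in> A \<union> B"
    using dT mem by (intro in_hull_imp[of d "{a1, a2, b1}"]) auto
  moreover have "d \<notin> A"
    using sum2[of a1 d b1 b2] mem by (auto simp: d_def)
  ultimately have dB: "d \<in> B" by blast
  have "z \<noteq> 0"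
    using not_in_A_segment[OF mem(1,2) dB xyz(1,2), of 1] d xyz by auto
  then have "0 < z" using xyz by auto
  \<comment> \<open>In \<open>(1 - v) *\<^sub>R d + (z * v) *\<^sub>R b2\<close> the terms in
    \<open>b1\<close> and \<open>b2\<close> form \<open>z\<close> times the old crossing point,
    which \<open>eq\<close> rewrites in \<open>a1\<close> and \<open>a2\<close>. Dividing by the
    total weight \<open>t\<close> gives the new crossing point \<open>m\<close>.\<close>
  define t where "t = (1 - v) + z * v"
  have t: "0 < t" using uv \<open>0 < z\<close> by (simp add: t_def add_pos_pos)
  have t': "t = z + (1 - v) * (x + y)"
  proof -
    have xy: "x + y = 1 - z" using xyz by simp
    show ?thesis unfolding t_def xy by (simp add: algebra_simps)
  qed
  define m where "m = ((1 - v) / t) *\<^sub>R d + (z * v / t) *\<^sub>R b2"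
  have "m \<in> convex hull {d, b2}"
    using m_def by (rule convex_hull_2I)
      (use uv \<open>0 < z\<close> t in \<open>auto simp: add_divide_distrib[symmetric] t_def\<close>)
  moreover have "m \<in> convex hull {a1, a2}"
  proof (rule convex_hull_2I)
    have "t *\<^sub>R m = (1 - v) *\<^sub>R d + (z * v) *\<^sub>R b2"
      using t by (simp add: m_def scaleR_add_right)
    also have "\<dots> = (1 - v) *\<^sub>R (x *\<^sub>R a1 + y *\<^sub>R a2) + z *\<^sub>R ((1 - v) *\<^sub>R b1 + v *\<^sub>R b2)"
      by (simp add: d algebra_simps)
    also have "\<dots> = (z * (1 - u) + (1 - v) * x) *\<^sub>R a1 + (z * u + (1 - v) * y) *\<^sub>R a2"
      unfolding eq[symmetric] by (simp add: algebra_simps)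
    finally have "(1 / t) *\<^sub>R t *\<^sub>R m = (1 / t) *\<^sub>R \<dots>" by simp
    then show "m = ((z * (1 - u) + (1 - v) * x) / t) *\<^sub>R a1 + ((z * u + (1 - v) * y) / t) *\<^sub>R a2"
      using t by (simp add: scaleR_add_right)
    show "0 \<le> (z * (1 - u) + (1 - v) * x) / t" "0 \<le> (z * u + (1 - v) * y) / t"
      using uv xyz t by (auto intro!: divide_nonneg_pos add_nonneg_nonneg mult_nonneg_nonneg)
    show "(z * (1 - u) + (1 - v) * x) / t + (z * u + (1 - v) * y) / t = 1"
      using t by (simp add: add_divide_distrib[symmetric]) (simp add: t' algebra_simps)
  qed
  ultimately have "crossing a1 a2 d b2"
    using mem dB unfolding crossing_def by blast
  moreover have "hull_count a1 a2 d b2 < hull_count a1 a2 b1 b2"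
  proof -
    let ?Q = "convex hull {a1, a2, b1, b2}"
    have "b1 \<notin> convex hull {a1, a2, b2}"
      using crossing_vertex mem uv eq by blast
    then have "b1 extreme_point_of ?Q"
      using extreme_point_of_convex_hull_insert[of "{a1, a2, b2}" b1] by (simp add: insert_commute)
    then have conv: "convex (?Q - {b1})"
      using extreme_point_of_stillconvex by blast
    have "b2 \<noteq> a1" using mem disjoint by auto
    then have "d \<noteq> b1" by (auto simp: d_def algebra_simps)
    moreover have "d \<in> ?Q" using dT hull_mono[of "{a1, a2, b1}" "{a1, a2, b1, b2}"] by auto
    moreover have "a1 \<noteq> b1" "a2 \<noteq> b1" using mem disjoint by auto
    moreover have "b2 \<noteq> b1"
      using \<open>b1 \<notin> convex hull {a1, a2, b2}\<close> by (auto simp: hull_inc)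
    ultimately have "{a1, a2, d, b2} \<subseteq> ?Q - {b1}" by (auto simp: hull_inc)
    then have "convex hull {a1, a2, d, b2} \<subseteq> ?Q - {b1}" using conv by (rule hull_minimal)
    moreover have "b1 \<in> (A \<union> B) \<inter> ?Q" using mem by (auto simp: hull_inc)
    ultimately have "(A \<union> B) \<inter> convex hull {a1, a2, d, b2} \<subset> (A \<union> B) \<inter> ?Q" by blast
    then show ?thesis
      unfolding hull_count_def using finite_A finite_B by (intro psubset_card_mono) auto
  qed
  ultimately show ?thesis by blast
qed

text \<open>The smallest of the four weights belongs to an \<open>A\<close>-end. Renaming the ends
  makes it the weight of the second \<open>A\<close>-end and gives the second \<open>B\<close>-end
  weight at least 1/2, as \<open>crossing_step_min\<close> requires.\<close>

lemma crossing_step_A: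
  assumes mem: "a1 \<in> A" "a2 \<in> A" "b1 \<in> B" "b2 \<in> B"
    and uv: "0 < u" "u < 1" "0 < v" "v < 1" "min u (1 - u) \<le> min v (1 - v)"
    and eq: "(1 - u) *\<^sub>R a1 + u *\<^sub>R a2 = (1 - v) *\<^sub>R b1 + v *\<^sub>R b2"
  shows "\<exists>b1' b2'. crossing a1 a2 b1' b2' \<and> hull_count a1 a2 b1' b2' < hull_count a1 a2 b1 b2"
proof -
  have *: ?thesis if "c \<in> A" "c' \<in> A" "{c, c'} = {a1, a2}" "0 < u" "u < 1" "u \<le> v" "u \<le> 1 - v"
    and eq: "(1 - u) *\<^sub>R c + u *\<^sub>R c' = (1 - v) *\<^sub>R b1 + v *\<^sub>R b2" for c c' u
  proof -
    have cr: "crossing c c' b b' \<longleftrightarrow> crossing a1 a2 b b'" "hull_count c c' b b' = hull_count a1 a2 b b'" for b b'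
    proof -
      have "{c, c', b, b'} = {c, c'} \<union> {b, b'}" by auto
      also have "\<dots> = {a1, a2, b, b'}" unfolding that(3) by auto
      finally show "hull_count c c' b b' = hull_count a1 a2 b b'" by (simp add: hull_count_def)
      show "crossing c c' b b' \<longleftrightarrow> crossing a1 a2 b b'"
        using that(1,2) mem by (simp add: crossing_def that(3))
    qed
    show ?thesis
    proof (cases "1 \<le> v + v")
      case True
      have "\<exists>d. crossing c c' d b2 \<and> hull_count c c' d b2 < hull_count c c' b1 b2"
        by (rule crossing_step_min[OF that(1,2) mem(3,4) that(4,5) _ _ _ _ eq])
          (use uv that True in auto)
      then show ?thesis unfolding cr by blast
    next
      case False
      have eq': "(1 - u) *\<^sub>R c + u *\<^sub>R c' = (1 - (1 - v)) *\<^sub>R b2 + (1 - v) *\<^sub>R b1"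
        using eq by (simp add: add.commute)
      have "\<exists>d. crossing c c' d b1 \<and> hull_count c c' d b1 < hull_count c c' b2 b1"
        by (rule crossing_step_min[OF that(1,2) mem(4,3) that(4,5) _ _ _ _ eq'])
          (use uv that False in auto)
      moreover have "hull_count a1 a2 b2 b1 = hull_count a1 a2 b1 b2"
        by (simp add: hull_count_def insert_commute)
      ultimately show ?thesis unfolding cr by metis
    qed
  qed
  show ?thesis
  proof (cases "u \<le> 1 - u")
    case True
    then show ?thesis using *[of a1 a2 u] mem uv eq by auto
  next
    case False
    then show ?thesis using *[of a2 a1 "1 - u"] mem uv eq by (auto simp: add.commute)
  qed
qed

text \<open>Exchanging the colours gives the locale its own copies of \<open>crossing\<close> and
  \<open>hull_count\<close>; this and the next lemma identify them with the originals.\<close>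

lemma swap_crossing:
  "lattice_coloring.crossing B A b1 b2 a1 a2 \<longleftrightarrow> crossing a1 a2 b1 b2"
  unfolding crossing_def lattice_coloring.crossing_def[OF lattice_coloring_swap] by blast

lemma swap_hull_count:
  "lattice_coloring.hull_count B A b1 b2 a1 a2 = hull_count a1 a2 b1 b2"
  unfolding hull_count_def lattice_coloring.hull_count_def[OF lattice_coloring_swap]
  by (simp add: insert_commute Un_commute)

text \<open>Descent on \<open>hull_count\<close>. A crossing at an end of a segment is excluded by
  the segment lemmas. Otherwise the segment carrying the smallest of the four weights is kept and
  the other one is replaced, giving a smaller crossing.\<close>

lemma no_crossing: "\<not> crossing a1 a2 b1 b2"
proof (induction "hull_count a1 a2 b1 b2" arbitrary: a1 a2 b1 b2 rule: less_induct)
  case less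
  show ?case
  proof
    assume cr: "crossing a1 a2 b1 b2"
    then have mem: "a1 \<in> A" "a2 \<in> A" "b1 \<in> B" "b2 \<in> B" by (auto simp: crossing_def)
    obtain u v where "0 \<le> u" "u \<le> 1" "0 \<le> v" "v \<le> 1"
      and eq: "(1 - u) *\<^sub>R a1 + u *\<^sub>R a2 = (1 - v) *\<^sub>R b1 + v *\<^sub>R b2"
    proof -
      from cr obtain m where "m \<in> closed_segment a1 a2" "m \<in> closed_segment b1 b2"
        unfolding crossing_def segment_convex_hull by blast
      then show ?thesis using that unfolding in_segment by metis
    qed
    moreover have "u \<noteq> 0" "u \<noteq> 1"
      using not_in_B_segment[OF mem(3,4,1), of "1 - v" v 1] not_in_B_segment[OF mem(3,4,2), of "1 - v" v 1]
        eq calculation by auto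
    moreover have "v \<noteq> 0" "v \<noteq> 1"
      using not_in_A_segment[OF mem(1,2,3), of "1 - u" u 1] not_in_A_segment[OF mem(1,2,4), of "1 - u" u 1]
        eq calculation by auto
    ultimately have uv: "0 < u" "u < 1" "0 < v" "v < 1" by auto
    show False
    proof (cases "min u (1 - u) \<le> min v (1 - v)")
      case True
      then show ?thesis using crossing_step_A[OF mem uv _ eq] less.hyps by blast
    next
      case False
      then have "min v (1 - v) \<le> min u (1 - u)" by linarith
      from lattice_coloring.crossing_step_A[OF lattice_coloring_swap mem(3,4,1,2) uv(3,4,1,2) this eq[symmetric]]
      obtain a1' a2' where "crossing a1' a2' b1 b2" "hull_count a1' a2' b1 b2 < hull_count a1 a2 b1 b2"
        unfolding swap_crossing swap_hull_count by blast
      then show ?thesis using less.hyps by blast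
    qed
  qed
qed

end

section \<open>Reduction to four points\<close>

text \<open>Apply Caratheodory's theorem to the point \<open>0\<close>, which lies in the convex hull of the points
  \<open>(a, 1)\<close> and \<open>(-b, -1)\<close>.\<close>

lemma caratheodory_disjoint_hulls:
  fixes A B :: "'a::euclidean_space set"
  assumes disj: "A \<inter> B = {}" and meet: "convex hull A \<inter> convex hull B \<noteq> {}"
  obtains V W where "V \<subseteq> A" "W \<subseteq> B" "finite V" "finite W" "card V + card W \<le> DIM('a) + 2"
    "convex hull V \<inter> convex hull W \<noteq> {}"
proof -
  define L :: "'a \<Rightarrow> 'a \<times> real" where "L = (\<lambda>a. (a, 1))"
  define R :: "'a \<Rightarrow> 'a \<times> real" where "R = (\<lambda>b. (- b, - 1))"
  define P where "P = L ` A \<union> R ` B"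
  obtain x where x: "x \<in> convex hull A" "x \<in> convex hull B" using meet by blast
  have "(x, 1) \<in> convex hull (L ` A)"
  proof -
    have "(x, 1) \<in> convex hull (A \<times> {1})"
      using x by (simp add: convex_hull_Times)
    also have "A \<times> {1} = L ` A" by (auto simp: L_def)
    finally show ?thesis .
  qed
  moreover have "(- x, - 1) \<in> convex hull (R ` B)"
  proof -
    have "convex hull (uminus ` B) = uminus ` (convex hull B)"
      by (simp add: convex_hull_linear_image module_hom_uminus)
    then have "- x \<in> convex hull (uminus ` B)" using x by simp
    then have "(- x, - 1) \<in> convex hull (uminus ` B \<times> {- 1})"
      by (simp add: convex_hull_Times)
    also have "uminus ` B \<times> {- 1 :: real} = R ` B" by (auto simp: R_def)
    finally show ?thesis .
  qed
  ultimately have "(x, 1) \<in> convex hull P" "(- x, - 1) \<in> convex hull P"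
    unfolding P_def by (meson Un_upper1 Un_upper2 hull_mono subsetD)+
  then have "(1/2) *\<^sub>R (x, 1) + (1/2) *\<^sub>R (- x, - 1) \<in> convex hull P"
    by (intro convexD[OF convex_convex_hull]) auto
  then have "0 \<in> convex hull P" by (simp add: zero_prod_def)
  \<comment> \<open>The lifted points live in one dimension more, whence the bound
    \<open>DIM('a) + 2\<close>.\<close>
  then obtain S where S: "finite S" "S \<subseteq> P" "card S \<le> DIM('a \<times> real) + 1" "0 \<in> convex hull S"
    using caratheodory[of P] by blast
  then obtain u where u: "\<And>s. s \<in> S \<Longrightarrow> 0 \<le> u s" "sum u S = 1" "(\<Sum>s\<in>S. u s *\<^sub>R s) = 0"
    unfolding convex_hull_finite[OF S(1)] by auto
  define V where "V = {a \<in> A. L a \<in> S}"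
  define W where "W = {b \<in> B. R b \<in> S}"
  have inj: "inj_on L V" "inj_on R W" by (auto simp: inj_on_def L_def R_def)
  have SVW: "S = L ` V \<union> R ` W" using S(2) by (auto simp: V_def W_def P_def)
  have dVW: "L ` V \<inter> R ` W = {}" by (auto simp: L_def R_def)
  have fin: "finite V" "finite W"
    using S(1) inj unfolding SVW by (auto intro: finite_imageD)
  have split: "sum f S = (\<Sum>a\<in>V. f (L a)) + (\<Sum>b\<in>W. f (R b))" for f :: "'a \<times> real \<Rightarrow> 'c::comm_monoid_add"
    unfolding SVW using fin dVW inj by (simp add: sum.union_disjoint sum.reindex)
  have cardS: "card S = card V + card W"
    unfolding SVW using fin dVW inj by (simp add: card_Un_disjoint card_image)
  \<comment> \<open>The first component equates the weighted sums, the second the total weights.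
    Each total is therefore 1/2, and doubling normalises it.\<close>
  have "fst (\<Sum>s\<in>S. u s *\<^sub>R s) = 0" "snd (\<Sum>s\<in>S. u s *\<^sub>R s) = 0" using u(3) by simp_all
  then have eqs: "(\<Sum>a\<in>V. u (L a) *\<^sub>R a) = (\<Sum>b\<in>W. u (R b) *\<^sub>R b)"
    "(\<Sum>a\<in>V. u (L a)) = (\<Sum>b\<in>W. u (R b))"
    unfolding split by (simp_all add: L_def R_def fst_sum snd_sum sum_negf)
  have half: "(\<Sum>a\<in>V. u (L a)) = 1/2" "(\<Sum>b\<in>W. u (R b)) = 1/2"
    using u(2) eqs(2) unfolding split by simp_all
  define m where "m = (\<Sum>a\<in>V. (2 * u (L a)) *\<^sub>R a)"
  have "m = (\<Sum>b\<in>W. (2 * u (R b)) *\<^sub>R b)"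
    using arg_cong[OF eqs(1), of "\<lambda>z. 2 *\<^sub>R z"] by (simp add: m_def scaleR_sum_right)
  then have "m \<in> convex hull W"
    unfolding convex_hull_finite[OF fin(2)] using u(1) half
    by (intro CollectI exI[of _ "\<lambda>b. 2 * u (R b)"]) (auto simp: W_def sum_distrib_left[symmetric])
  moreover have "m \<in> convex hull V"
    unfolding convex_hull_finite[OF fin(1)] using u(1) half
    by (intro CollectI exI[of _ "\<lambda>a. 2 * u (L a)"]) (auto simp: V_def m_def sum_distrib_left[symmetric])
  ultimately show thesis
    using that[of V W] S(3) cardS fin by (auto simp: V_def W_def)
qed

text \<open>At most four points remain and both colours occur, so one point meets at most three, or
  two meet two.\<close>

lemma (in lattice_coloring) disjoint_hulls:
  assumes dim: "DIM('a) = 2"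
  shows "convex hull A \<inter> convex hull B = {}"
proof (rule ccontr)
  assume "\<not> ?thesis"
  then obtain V W where VW: "V \<subseteq> A" "W \<subseteq> B" "finite V" "finite W" "card V + card W \<le> 4"
    and meet: "convex hull V \<inter> convex hull W \<noteq> {}"
    using caratheodory_disjoint_hulls[OF disjoint] dim by (metis numeral_Bit0)
  have "card V \<noteq> 0" "card W \<noteq> 0" using VW meet by auto
  then consider "card V = 1" "card W \<le> 3" | "card W = 1" "card V \<le> 3" | "card V = 2" "card W = 2"
    using VW by linarith
  then show False
  proof cases
    case 1
    then obtain a where "V = {a}" using card_1_singletonE by blast
    then show False using no_A_in_hull3[of W] VW 1 meet by auto
  next
    case 2
    then obtain b where "W = {b}" using card_1_singletonE by blast
    then show False using no_B_in_hull3[of V] VW 2 meet by auto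
  next
    case 3
    then obtain a1 a2 b1 b2 where "V = {a1, a2}" "W = {b1, b2}" by (meson card_2_iff)
    then show False using no_crossing[of a1 a2 b1 b2] VW meet by (auto simp: crossing_def)
  qed
qed

section \<open>From Condition H to the parallelogram condition\<close>

text \<open>A functional separating a point of \<open>L - P\<close> from \<open>P\<close> is
  constant on \<open>P\<close> and cuts \<open>L\<close> exactly in \<open>P\<close>. By
  connectedness each component of \<open>L - P\<close> stays on one side; negating the functional if
  necessary puts \<open>A\<close> on the upper side.\<close>

lemma separates_in_functional:
  fixes L P A B :: "(real ^ 'd) set"
  assumes sep: "separates_in L P A B" and disj: "A \<inter> B = {}" and nonempty: "P \<noteq> {}"
  obtains n c where "\<And>x. x \<in> A \<inter> L \<Longrightarrow> c \<le> n \<bullet> x" "\<And>x. x \<in> B \<inter> L \<Longrightarrow> n \<bullet> x \<le> c"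
    "\<And>x. x \<in> L \<Longrightarrow> n \<bullet> x = c \<Longrightarrow> x \<in> P"
proof -
  from sep obtain Rp Rm where L: "affine L" and P: "affine P" "P \<subseteq> L" "aff_dim P = aff_dim L - 1"
    and R: "Rp \<in> components (L - P)" "Rm \<in> components (L - P)" "Rp \<union> Rm = L - P"
    and col: "Rp \<inter> (A \<union> B) \<subseteq> A" "Rm \<inter> (A \<union> B) \<subseteq> B"
    unfolding separates_in_def by blast
  obtain p where p: "p \<in> P" using nonempty by blast
  have "P \<noteq> L" using P(3) by auto
  then obtain z where z: "z \<in> L" "z \<notin> P" using P(2) by blast
  obtain a b where ab: "a \<bullet> z < b" "\<And>x. x \<in> P \<Longrightarrow> b < a \<bullet> x"
    using separating_hyperplane_closed_point[OF affine_imp_convex[OF P(1)] affine_closed[OF P(1)] z(2)]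
    by blast
  have const: "a \<bullet> x = a \<bullet> p" if x: "x \<in> P" for x
  proof (rule ccontr)
    assume ne: "a \<bullet> x \<noteq> a \<bullet> p"
    \<comment> \<open>The parameter at which the line through \<open>p\<close> and \<open>x\<close>
      would reach level \<open>b\<close>, although it stays inside \<open>P\<close>.\<close>
    define t where "t = (b - a \<bullet> p) / (a \<bullet> x - a \<bullet> p)"
    have "(1 - t) *\<^sub>R p + t *\<^sub>R x \<in> P" using P(1) p x by (auto simp: affine_alt)
    from ab(2)[OF this] have "b < a \<bullet> p + t * (a \<bullet> x - a \<bullet> p)"
      by (simp add: inner_add_right algebra_simps)
    also have "t * (a \<bullet> x - a \<bullet> p) = b - a \<bullet> p" using ne by (simp add: t_def)
    finally show False by simp
  qed
  define c where "c = a \<bullet> p"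
  have zc: "a \<bullet> z < c" using ab p unfolding c_def by (metis less_trans)
  \<comment> \<open>The hyperplane does not contain \<open>L\<close>, so its trace on
    \<open>L\<close> has the dimension of \<open>P\<close>, which it contains.\<close>
  have LP: "L \<inter> {x. a \<bullet> x = c} = P"
  proof (rule sym, rule affine_dim_equal)
    have "L \<inter> {v. a \<bullet> v = c} \<noteq> {}" "\<not> L \<subseteq> {v. a \<bullet> v = c}"
      using p P(2) z zc by (auto simp: c_def)
    then show "aff_dim P = aff_dim (L \<inter> {x. a \<bullet> x = c})"
      using aff_dim_affine_Int_hyperplane[OF L, of a c] P(3) by simp
    show "affine (L \<inter> {x. a \<bullet> x = c})"
      using L affine_hyperplane by (rule affine_Int)
  qed (use P nonempty const in \<open>auto simp: c_def\<close>)
  have sides: "(\<forall>x\<in>C. c < a \<bullet> x) \<or> (\<forall>x\<in>C. a \<bullet> x < c)" if C: "C \<in> components (L - P)" for C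
  proof (rule ccontr)
    assume "\<not> ?thesis"
    then obtain x y where "x \<in> C" "y \<in> C" "a \<bullet> x \<le> c" "c \<le> a \<bullet> y" by (auto simp: not_less)
    then obtain w where "w \<in> C" "a \<bullet> w = c"
      using connected_ivt_hyperplane[OF in_components_connected[OF C]] by metis
    then show False using in_components_subset[OF C] LP by blast
  qed
  \<comment> \<open>The reflection of \<open>z\<close> in \<open>p\<close> lies on the opposite
    side, so the two components cannot share a side.\<close>
  define z' where "z' = 2 *\<^sub>R p - z"
  have z': "z' \<in> L"
    using L z p P(2) mem_affine[OF L, of p z 2 "- 1"] by (auto simp: z'_def)
  have z'c: "c < a \<bullet> z'" using zc by (simp add: z'_def inner_diff_right c_def)
  have "z \<in> Rp \<union> Rm" "z' \<in> Rp \<union> Rm"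
    using z z' zc z'c unfolding R(3) LP[symmetric] by auto
  then consider "\<forall>x\<in>Rp. c < a \<bullet> x" "\<forall>x\<in>Rm. a \<bullet> x < c" | "\<forall>x\<in>Rp. a \<bullet> x < c" "\<forall>x\<in>Rm. c < a \<bullet> x"
    using sides[OF R(1)] sides[OF R(2)] zc z'c by (auto; force)
  then show thesis
  proof cases
    case 1
    show thesis
    proof (rule that[of c a])
      show "c \<le> a \<bullet> x" if "x \<in> A \<inter> L" for x
        using that col disj R(3) LP 1(1) by fastforce
      show "a \<bullet> x \<le> c" if "x \<in> B \<inter> L" for x
        using that col disj R(3) LP 1(2) by fastforce
    qed (use LP in auto)
  next
    case 2
    show thesis
    proof (rule that[of "- c" "- a"])
      show "- c \<le> - a \<bullet> x" if "x \<in> A \<inter> L" for x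
        using that col disj R(3) LP 2(1) by fastforce
      show "- a \<bullet> x \<le> - c" if "x \<in> B \<inter> L" for x
        using that col disj R(3) LP 2(2) by fastforce
    qed (use LP in auto)
  qed
qed

lemma condition_H_imp_parallelogram_condition:
  fixes A B :: "(real ^ 'd) set"
  assumes "condition_H A B" and disj: "A \<inter> B = {}"
  shows "parallelogram_condition m A B"
proof -
  obtain k H where k: "k \<le> CARD('d)"
    and dims: "\<forall>i \<in> {k..CARD('d)}. affine (H i) \<and> aff_dim (H i :: (real ^ 'd) set) = int i"
    and top: "H CARD('d) = UNIV"
    and bot: "H k \<inter> (A \<union> B) \<subseteq> A \<or> H k \<inter> (A \<union> B) \<subseteq> B"
    and sep: "\<forall>i \<in> {k + 1..CARD('d)}. separates_in (H i) (H (i - 1)) A B"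
    using assms(1) unfolding condition_H_def by blast
  have flag: "(\<Sum>j = 1..l. a j) \<noteq> (\<Sum>j = 1..l. b j)"
    if "k \<le> i" "i \<le> CARD('d)" "1 \<le> l" "\<forall>j\<in>{1..l}. a j \<in> A \<inter> H i" "\<forall>j\<in>{1..l}. b j \<in> B \<inter> H i"
    for i l and a b :: "nat \<Rightarrow> real ^ 'd"
    using that
  proof (induction i rule: dec_induct)
    case base
    then have "a 1 \<in> A \<inter> H k" "b 1 \<in> B \<inter> H k" by auto
    then show ?case using bot disj by blast
  next
    case (step i)
    show ?case
    proof
      assume eq: "(\<Sum>j = 1..l. a j) = (\<Sum>j = 1..l. b j)"
      have "separates_in (H (Suc i)) (H i) A B"
        using sep[rule_format, of "Suc i"] step by simp
      moreover have "H i \<noteq> {}" using dims[rule_format, of i] step by auto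
      ultimately obtain n c where n: "\<And>x. x \<in> A \<inter> H (Suc i) \<Longrightarrow> c \<le> n \<bullet> x"
        "\<And>x. x \<in> B \<inter> H (Suc i) \<Longrightarrow> n \<bullet> x \<le> c" "\<And>x. x \<in> H (Suc i) \<Longrightarrow> n \<bullet> x = c \<Longrightarrow> x \<in> H i"
        using separates_in_functional[OF _ disj] by metis
      have A: "0 \<le> n \<bullet> a j - c" and B: "0 \<le> c - n \<bullet> b j" if "j \<in> {1..l}" for j
        using n step.prems that by auto
      \<comment> \<open>Both sums have \<open>l\<close> terms, so \<open>c\<close> cancels. Equal
        sums thus make the nonnegative gaps add up to 0, and every term drops into
        \<open>H i\<close>.\<close>
      have "(\<Sum>j = 1..l. n \<bullet> a j - c) + (\<Sum>j = 1..l. c - n \<bullet> b j) =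
        n \<bullet> (\<Sum>j = 1..l. a j) - n \<bullet> (\<Sum>j = 1..l. b j)"
        by (simp add: inner_sum_right sum_subtractf)
      also have "\<dots> = 0" unfolding eq by simp
      finally have "(\<Sum>j = 1..l. n \<bullet> a j - c) + (\<Sum>j = 1..l. c - n \<bullet> b j) = 0" .
      then have "(\<Sum>j = 1..l. n \<bullet> a j - c) = 0" "(\<Sum>j = 1..l. c - n \<bullet> b j) = 0"
        using sum_nonneg[OF A, of "{1..l}" "\<lambda>j. j"] sum_nonneg[OF B, of "{1..l}" "\<lambda>j. j"] by auto
      then have "\<forall>j\<in>{1..l}. n \<bullet> a j - c = 0" "\<forall>j\<in>{1..l}. c - n \<bullet> b j = 0"
        using A B sum_nonneg_eq_0_iff[of "{1..l}" "\<lambda>j. n \<bullet> a j - c"]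
          sum_nonneg_eq_0_iff[of "{1..l}" "\<lambda>j. c - n \<bullet> b j"] by blast+
      then have "\<forall>j\<in>{1..l}. a j \<in> A \<inter> H i" "\<forall>j\<in>{1..l}. b j \<in> B \<inter> H i"
        using n(3) step.prems by auto
      then show False using step.IH step.prems step.hyps eq by auto
    qed
  qed
  show ?thesis
    unfolding parallelogram_condition_def using flag[of "CARD('d)"] k top by auto
qed

section \<open>From strict separation to Condition H\<close>

text \<open>The half-space is convex, hence connected, and a connected set reaching beyond it would
  meet the hyperplane.\<close>

lemma halfspace_gt_component:
  fixes n :: "'a::euclidean_space"
  assumes "n \<noteq> 0"
  shows "{x. c < n \<bullet> x} \<in> components (UNIV - {x. n \<bullet> x = c})"
  unfolding in_components_maximal
proof (intro conjI allI impI)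
  have "n \<bullet> (((c + 1) / (n \<bullet> n)) *\<^sub>R n) = c + 1" using assms by simp
  then show ne: "{x. c < n \<bullet> x} \<noteq> {}" by (metis (mono_tags) empty_Collect_eq less_add_one)
  show "connected {x. c < n \<bullet> x}"
    by (simp add: convex_connected convex_halfspace_gt)
  fix D assume D: "D \<noteq> {} \<and> {x. c < n \<bullet> x} \<subseteq> D \<and> D \<subseteq> UNIV - {x. n \<bullet> x = c} \<and> connected D"
  obtain y where y: "y \<in> D" "c < n \<bullet> y" using ne D by blast
  have "c < n \<bullet> x" if "x \<in> D" for x
  proof (rule ccontr)
    assume "\<not> c < n \<bullet> x"
    then have "\<exists>w\<in>D. n \<bullet> w = c"
      using D y that by (intro connected_ivt_hyperplane[of D x y]) auto
    then show False using D by blast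
  qed
  then show "D = {x. c < n \<bullet> x}" using D by blast
qed auto

lemma strictly_separated_imp_condition_H:
  fixes A B :: "(real ^ 'd) set"
  assumes "n \<noteq> 0" and A: "\<And>x. x \<in> A \<Longrightarrow> c < n \<bullet> x" and B: "\<And>x. x \<in> B \<Longrightarrow> n \<bullet> x < c"
  shows "condition_H A B"
proof -
  define P where "P = {x. n \<bullet> x = c}"
  \<comment> \<open>The flag starts at \<open>k = CARD('d) - 1\<close> with the separating
    hyperplane, which contains no point of either colour.\<close>
  define H where "H = (\<lambda>i. if i = CARD('d) then UNIV else P)"
  have dimP: "affine P" "aff_dim P = int (CARD('d) - 1)"
    using assms(1) by (simp_all add: P_def affine_hyperplane of_nat_diff)
  have "{x. n \<bullet> x < c} \<in> components (UNIV - P)"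
    using halfspace_gt_component[of "- n" "- c"] assms(1) by (simp add: P_def)
  moreover have "{x. c < n \<bullet> x} \<in> components (UNIV - P)"
    using halfspace_gt_component[of n c] assms(1) by (simp add: P_def)
  ultimately have "separates_in UNIV P A B"
    unfolding separates_in_def using dimP A B
    by (intro conjI bexI[of _ "{x. c < n \<bullet> x}"] bexI[of _ "{x. n \<bullet> x < c}"])
      (force simp: P_def of_nat_diff)+
  moreover have "P \<inter> (A \<union> B) = {}" using A B by (force simp: P_def)
  moreover have "i = CARD('d) - 1 \<or> i = CARD('d)" if "i \<in> {CARD('d) - 1..CARD('d)}" for i
    using that by auto
  moreover have "0 < CARD('d)" by simp
  moreover then have "CARD('d) - 1 \<noteq> CARD('d)" by linarith
  ultimately show ?thesis
    unfolding condition_H_def using dimP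
    by (intro exI[of _ "CARD('d) - 1"] exI[of _ H] conjI) (auto simp: H_def aff_dim_UNIV)
qed

section \<open>The equivalence in the plane\<close>

theorem theorem4p2:
  fixes S A B :: "(real ^ 2) set"
  assumes "S \<subseteq> int_lattice"
    and "finite S"
    and "hole_free S"
    and "A \<subseteq> S"
    and "B = S - A"
    and "A \<noteq> {}"
    and "B \<noteq> {}"
  shows "condition_H A B \<longleftrightarrow> parallelogram_condition 3 A B"
proof
  have disj: "A \<inter> B = {}" and AB: "A \<union> B = S" and fin: "finite A" "finite B"
    using assms finite_subset by auto
  show "parallelogram_condition 3 A B" if "condition_H A B"
    using that disj by (rule condition_H_imp_parallelogram_condition)
  assume par: "parallelogram_condition 3 A B"
  have pc: "(\<Sum>i = 1..k. a i) \<noteq> (\<Sum>i = 1..k. b i)"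
    if "k \<in> {1..3}" "\<forall>i \<in> {1..k}. a i \<in> A" "\<forall>i \<in> {1..k}. b i \<in> B" for k and a b :: "nat \<Rightarrow> real ^ 2"
    using par that unfolding parallelogram_condition_def by blast
  \<comment> \<open>Lists allow explicit sums of two and three terms; the shift \<open>i - 1\<close>
    reconciles indices starting at 1 with \<open>nth\<close>.\<close>
  have lists: "sum_list as \<noteq> sum_list bs"
    if "set as \<subseteq> A" "set bs \<subseteq> B" "length as = length bs" "length as \<in> {1..3}" for as bs
  proof -
    have *: "sum_list xs = (\<Sum>i = 1..length xs. xs ! (i - 1))" for xs :: "(real ^ 2) list"
      by (simp add: sum_list_sum_nth atLeast0LessThan sum.atLeast1_atMost_eq)
    show ?thesis
      unfolding * that(3)
      by (rule pc) (use that in \<open>auto intro!: subsetD[OF that(1)] subsetD[OF that(2)] nth_mem\<close>)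
  qed
  interpret lattice_coloring int_lattice A B
  proof
    show "x - y \<in> int_lattice" if "x \<in> int_lattice" "y \<in> int_lattice" for x y :: "real ^ 2"
      using that by (simp add: int_lattice_def)
    show "x \<in> A \<union> B" if "x \<in> convex hull (A \<union> B)" "x \<in> int_lattice" for x
      using that assms(3) unfolding AB hole_free_def by blast
    show "a1 + a2 \<noteq> b1 + b2" if "a1 \<in> A" "a2 \<in> A" "b1 \<in> B" "b2 \<in> B" for a1 a2 b1 b2
      using lists[of "[a1, a2]" "[b1, b2]"] that by simp
    show "a1 + a2 + a3 \<noteq> b1 + b2 + b3"
      if "a1 \<in> A" "a2 \<in> A" "a3 \<in> A" "b1 \<in> B" "b2 \<in> B" "b3 \<in> B" for a1 a2 a3 b1 b2 b3
      using lists[of "[a1, a2, a3]" "[b1, b2, b3]"] that by (simp add: add.assoc)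
  qed (use fin disj AB assms in auto)
  have "convex hull A \<inter> convex hull B = {}"
    by (rule disjoint_hulls) simp
  \<comment> \<open>The order is reversed because \<open>A\<close> must lie on the upper side of the
    separating line.\<close>
  then have "convex hull B \<inter> convex hull A = {}" by blast
  then obtain n c where nc: "\<forall>x\<in>convex hull B. n \<bullet> x < c" "\<forall>x\<in>convex hull A. c < n \<bullet> x"
    using separating_hyperplane_closed_compact[of "convex hull B" "convex hull A"] fin assms(6)
    by (auto simp: finite_imp_compact_convex_hull compact_imp_closed)
  obtain a b where "a \<in> A" "b \<in> B" using assms by blast
  then have "n \<noteq> 0" using nc by (force simp: hull_inc)
  then show "condition_H A B"
    using nc by (intro strictly_separated_imp_condition_H) (auto simp: hull_inc)
qed

end
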